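(* Let $A$ be a locally convex Abelian algebra (respectively, a locally convex Abelian $*$-algebra), and let $\Delta_A$ be its Gel'fand spectrum, i.e. the set of all continuous algebra homomorphisms (respectively, continuous $*$-homomorphisms) $A\to\mathbb{C}$. Then $\Delta_A$ is a weak${}^*$-closed subset of the topological dual $A^*$, and with the topology inherited from the weak${}^*$ topology of $A^*$ it is a Tychonoff (completely regular, Hausdorff) space.
   Context: An algebra is a complex vector space $A$ with an associative bilinear multiplication and a unit $1_A$; it is Abelian if $ab=ba$ for all $a,b$. Algebra homomorphisms are linear, multiplicative and map unit to unit. A $*$-algebra is an algebra with an involution $*\colon A\to A$, i.e. an anti-linear map with $a^{**}=a$, $(z1_A)^*=\bar z1_A$ and $(ab)^*=b^*a^*$; a $*$-homomorphism is an algebra homomorphism $f$ with $f(a^* )=f(a)^*$ for all $a$. $\mathbb{C}$ is a $*$-algebra under complex conjugation, with its usual topology. A locally convex algebra (or $*$-algebra) is an algebra (or $*$-algebra) with a locally convex vector space topology making all the algebra operations (and the involution) continuous. The topological dual $A^*$ is the space of continuous linear functionals $A\to\mathbb{C}$; its weak${}^*$ topology is the weakest topology making all evaluations $p\mapsto p(a)$, $a\in A$, continuous. *)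

theory Defs
  imports "HOL-Analysis.Analysis"
begin

text \<open>The superclass \<^class>\<open>real_vector\<close> carries no extra data: its scalar multiplication is
  the restriction of the complex one. It gives access to the library's \<^const>\<open>convex\<close>.\<close>

class complex_vector = real_vector +
  fixes scaleC :: "complex \<Rightarrow> 'a \<Rightarrow> 'a"  (infixr \<open>*\<^sub>C\<close> 75)
  assumes scaleR_eq_scaleC: "r *\<^sub>R x = complex_of_real r *\<^sub>C x"
    and scaleC_add_right: "z *\<^sub>C (x + y) = z *\<^sub>C x + z *\<^sub>C y"
    and scaleC_add_left: "(z + w) *\<^sub>C x = z *\<^sub>C x + w *\<^sub>C x"
    and scaleC_scaleC: "z *\<^sub>C (w *\<^sub>C x) = (z * w) *\<^sub>C x"
    and scaleC_one: "1 *\<^sub>C x = x"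

text \<open>The class \<^class>\<open>monoid_mult\<close> is used instead of \<^class>\<open>ring_1\<close>, since the latter assumes
  \<open>0 \<noteq> 1\<close> and so would exclude the zero algebra.\<close>

class unital_algebra = complex_vector + ring + monoid_mult +
  assumes scaleC_mult_left: "(z *\<^sub>C a) * b = z *\<^sub>C (a * b)"
    and scaleC_mult_right: "a * (z *\<^sub>C b) = z *\<^sub>C (a * b)"

class star_algebra = unital_algebra +
  fixes star :: "'a \<Rightarrow> 'a"
  assumes star_add: "star (a + b) = star a + star b"
    and star_scaleC: "star (z *\<^sub>C a) = cnj z *\<^sub>C star a"
    and star_star: "star (star a) = a"
    and star_scaleC_one: "star (z *\<^sub>C 1) = cnj z *\<^sub>C 1"
    and star_mult: "star (a * b) = star b * star a"

text \<open>The two topological superclasses make addition, negation and multiplication (jointly)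
  continuous. No separation axiom is imposed on the topology. As in these superclasses, continuity
  is stated with filters, and \<^const>\<open>convex\<close> is unfolded, because the derived constants are not
  available at the class's own type inside a class specification; the lemmas below recover the
  usual forms.\<close>

class locally_convex_algebra =
  unital_algebra + topological_ab_group_add + topological_semigroup_mult +
  assumes tendsto_scaleC_Pair:
      "LIM p (nhds z \<times>\<^sub>F nhds a). fst p *\<^sub>C snd p :> nhds (z *\<^sub>C a)"
    and locally_convex_unfolded:
      "open U \<Longrightarrow> 0 \<in> U \<Longrightarrow> \<exists>V W. open W \<and> 0 \<in> W \<and> W \<subseteq> V \<and> V \<subseteq> U \<and>
        (\<forall>x\<in>V. \<forall>y\<in>V. \<forall>u\<ge>0. \<forall>v\<ge>0. u + v = 1 \<longrightarrow> u *\<^sub>R x + v *\<^sub>R y \<in> V)"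

class locally_convex_star_algebra = locally_convex_algebra + star_algebra +
  assumes tendsto_star: "(star \<longlongrightarrow> star a) (nhds a)"

lemma continuous_scaleC:
  "continuous_on UNIV (\<lambda>(z, a::'a::locally_convex_algebra). z *\<^sub>C a)"
  using tendsto_scaleC_Pair
  by (auto simp: continuous_on_def case_prod_unfold nhds_prod[symmetric] at_within_def
      intro: tendsto_mono[OF inf_le1])

lemma locally_convex:
  fixes U :: "'a::locally_convex_algebra set"
  assumes "open U" "0 \<in> U"
  shows "\<exists>V. 0 \<in> interior V \<and> V \<subseteq> U \<and> convex V"
proof -
  obtain V W where "open W" "0 \<in> W" "W \<subseteq> V" "V \<subseteq> U" "convex V"
    using locally_convex_unfolded[OF assms] unfolding convex_def by blast
  then show ?thesis
    by (meson interiorI)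
qed

lemma continuous_star: "continuous_on UNIV (star :: 'a::locally_convex_star_algebra \<Rightarrow> 'a)"
  using tendsto_star
  by (auto simp: continuous_on_def at_within_def intro: tendsto_mono[OF inf_le1])

instantiation complex :: locally_convex_star_algebra
begin

definition scaleC_complex :: "complex \<Rightarrow> complex \<Rightarrow> complex"
  where "scaleC_complex z w = z * w"

definition star_complex :: "complex \<Rightarrow> complex"
  where "star_complex = cnj"

instance
proof
  fix z a :: complex
  show "LIM p (nhds z \<times>\<^sub>F nhds a). fst p *\<^sub>C snd p :> nhds (z *\<^sub>C a)"
    unfolding scaleC_complex_def by (rule tendsto_mult_Pair)
  show "(star \<longlongrightarrow> star a) (nhds a)"
    unfolding star_complex_def by (intro tendsto_intros filterlim_ident)
next
  fix U :: "complex set"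
  assume "open U" "0 \<in> U"
  then obtain e where "e > 0" "ball 0 e \<subseteq> U"
    using open_contains_ball by blast
  then have "open (ball (0::complex) e) \<and> 0 \<in> ball (0::complex) e \<and> ball (0::complex) e \<subseteq> ball 0 e
      \<and> ball 0 e \<subseteq> U \<and> convex (ball (0::complex) e)"
    by simp
  then show "\<exists>V W. open W \<and> 0 \<in> W \<and> W \<subseteq> V \<and> V \<subseteq> U \<and>
      (\<forall>x\<in>V. \<forall>y\<in>V. \<forall>u\<ge>0. \<forall>v\<ge>0. u + v = 1 \<longrightarrow> u *\<^sub>R x + v *\<^sub>R y \<in> V)"
    unfolding convex_def by blast
qed (auto simp: scaleC_complex_def star_complex_def scaleR_conv_of_real algebra_simps)

end

definition complex_linear :: "('a::complex_vector \<Rightarrow> 'b::complex_vector) \<Rightarrow> bool"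
  where "complex_linear f \<longleftrightarrow>
    (\<forall>x y. f (x + y) = f x + f y) \<and> (\<forall>z x. f (z *\<^sub>C x) = z *\<^sub>C f x)"

definition algebra_hom :: "('a::unital_algebra \<Rightarrow> 'b::unital_algebra) \<Rightarrow> bool"
  where "algebra_hom f \<longleftrightarrow>
    complex_linear f \<and> (\<forall>a b. f (a * b) = f a * f b) \<and> f 1 = 1"

definition star_hom :: "('a::star_algebra \<Rightarrow> 'b::star_algebra) \<Rightarrow> bool"
  where "star_hom f \<longleftrightarrow> algebra_hom f \<and> (\<forall>a. f (star a) = star (f a))"

definition topological_dual :: "('a::{complex_vector, topological_space} \<Rightarrow> complex) set"
  where "topological_dual = {p. complex_linear p \<and> continuous_on UNIV p}"

definition weak_star_topology ::
    "('a::{complex_vector, topological_space} \<Rightarrow> complex) topology"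
  where "weak_star_topology =
    topology_generated_by {{p \<in> topological_dual. p a \<in> U} |a U. open U}"

lemma topspace_weak_star_topology: "topspace weak_star_topology = topological_dual"
  by (auto simp: weak_star_topology_def intro: exI[of _ UNIV])

definition gelfand_spectrum :: "('a::locally_convex_algebra \<Rightarrow> complex) set"
  where "gelfand_spectrum = {h. algebra_hom h \<and> continuous_on UNIV h}"

definition star_gelfand_spectrum :: "('a::locally_convex_star_algebra \<Rightarrow> complex) set"
  where "star_gelfand_spectrum = {h. star_hom h \<and> continuous_on UNIV h}"

definition tychonoff_space :: "'a topology \<Rightarrow> bool"
  where "tychonoff_space X \<longleftrightarrow> completely_regular_space X \<and> Hausdorff_space X"

end

theory Submission
  imports Defs
begin

text \<open>The weak* topology is the topology of pointwise convergence: it is the one that the dual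
  inherits from the product \<open>\<complex>\<^sup>A\<close> of copies of the complex plane (lemma
  \<open>weak_star_topology_eq_subtopology\<close>). The plane is metrizable, so it is completely regular and
  Hausdorff; both properties pass to products and to subspaces, hence to every subset of the dual.

  For closedness, each condition that singles out the characters among the continuous functionals,
  \<open>h (a * b) = h a * h b\<close>, \<open>h 1 = 1\<close> and \<open>h (star a) = cnj (h a)\<close>, equates two weak*-continuous
  complex functions of \<open>h\<close>, because each side depends continuously on finitely many values of \<open>h\<close>.
  So each condition defines a closed set, and the spectrum is the intersection of these sets.
  Closedness is meant inside the dual, so linearity and continuity hold from the start and only
  these conditions have to survive weak* limits.\<close>

lemma continuous_map_weak_star_eval:
  "continuous_map weak_star_topology euclidean (\<lambda>p. p a)"
proof -
  have "openin weak_star_topology {p \<in> topological_dual. p a \<in> U}" if "open U" for U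
    unfolding weak_star_topology_def using that by (intro topology_generated_by_Basis) blast
  then show ?thesis
    by (simp add: continuous_map_def topspace_weak_star_topology)
qed

text \<open>Both topologies are the coarsest on the dual for which the evaluations are continuous, so the
  identity is continuous in either direction.\<close>

lemma weak_star_topology_eq_subtopology:
  "weak_star_topology = subtopology (product_topology (\<lambda>_. euclidean) UNIV) topological_dual"
  (is "?W = ?P")
proof -
  have "continuous_map ?W ?P (\<lambda>p. p)"
    by (auto simp: continuous_map_in_subtopology continuous_map_componentwise_UNIV
        topspace_weak_star_topology continuous_map_weak_star_eval)
  moreover have "continuous_map ?P ?W (\<lambda>p. p)"
    unfolding weak_star_topology_def
  proof (rule continuous_on_generated_topo)
    fix S :: "('a \<Rightarrow> complex) set"
    assume "S \<in> {{p \<in> topological_dual. p a \<in> U} |a U. open U}"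
    then obtain a U where S: "S = {p \<in> topological_dual. p a \<in> U}" and "open U"
      by blast
    have "continuous_map ?P euclidean (\<lambda>p. p a)"
      by (intro continuous_map_from_subtopology continuous_map_product_projection) simp
    then have "openin ?P {p \<in> topspace ?P. p a \<in> U}"
      using \<open>open U\<close> by (intro openin_continuous_map_preimage) auto
    moreover have "(\<lambda>p. p) -` S \<inter> topspace ?P = {p \<in> topspace ?P. p a \<in> U}"
      by (auto simp: S)
    ultimately show "openin ?P ((\<lambda>p. p) -` S \<inter> topspace ?P)"
      by simp
  next
    show "(\<lambda>p. p) ` topspace ?P \<subseteq> \<Union> {{p \<in> topological_dual. p a \<in> U} |a U. open U}"
      by (auto intro: exI[of _ UNIV])
  qed
  ultimately have "homeomorphic_maps ?W ?P id id"
    by (simp add: homeomorphic_maps_def id_def)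
  then show ?thesis
    by (simp only: homeomorphic_maps_id)
qed

lemma tychonoff_space_subtopology_weak_star:
  "tychonoff_space (subtopology weak_star_topology S)"
  unfolding tychonoff_space_def weak_star_topology_eq_subtopology
  by (intro conjI completely_regular_space_subtopology Hausdorff_space_subtopology)
    (auto simp: completely_regular_space_product_topology Hausdorff_space_product_topology
      intro: metrizable_imp_completely_regular_space metrizable_space_euclidean)

lemma closedin_weak_star_eq:
  fixes f g :: "('a::{complex_vector, topological_space} \<Rightarrow> complex) \<Rightarrow> complex"
  assumes "continuous_map weak_star_topology euclidean f"
    and "continuous_map weak_star_topology euclidean g"
  shows "closedin weak_star_topology {p \<in> topological_dual. f p = g p}"
  using closedin_continuous_maps_eq[OF _ assms] by (simp add: topspace_weak_star_topology)

lemma gelfand_spectrum_eq: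
  "gelfand_spectrum = {p \<in> topological_dual. p 1 = 1}
    \<inter> (\<Inter>a. \<Inter>b. {p \<in> topological_dual. p (a * b) = p a * p b})"
  by (auto simp: gelfand_spectrum_def topological_dual_def algebra_hom_def)

lemma star_gelfand_spectrum_eq:
  "star_gelfand_spectrum
    = gelfand_spectrum \<inter> (\<Inter>a. {p \<in> topological_dual. p (star a) = cnj (p a)})"
  by (auto simp: star_gelfand_spectrum_def gelfand_spectrum_def topological_dual_def
      algebra_hom_def star_hom_def star_complex_def)

lemma closedin_gelfand_spectrum:
  "closedin weak_star_topology (gelfand_spectrum :: ('a::locally_convex_algebra \<Rightarrow> complex) set)"
proof -
  have "continuous_map weak_star_topology euclidean (\<lambda>p. p a * p b)" for a b :: 'a
    using continuous_map_weak_star_eval[of a] continuous_map_weak_star_eval[of b]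
    by (simp add: continuous_map_atin tendsto_mult)
  then show ?thesis
    unfolding gelfand_spectrum_eq
    by (intro closedin_Int closedin_INT closedin_weak_star_eq continuous_map_weak_star_eval) auto
qed

lemma closedin_star_gelfand_spectrum:
  "closedin weak_star_topology
    (star_gelfand_spectrum :: ('a::locally_convex_star_algebra \<Rightarrow> complex) set)"
proof -
  have "continuous_map weak_star_topology euclidean (\<lambda>p. cnj (p a))" for a :: 'a
    using continuous_map_compose[OF continuous_map_weak_star_eval, of euclidean cnj a]
    by (simp add: o_def continuous_on_cnj)
  then show ?thesis
    unfolding star_gelfand_spectrum_eq
    by (intro closedin_Int closedin_INT closedin_weak_star_eq closedin_gelfand_spectrum
        continuous_map_weak_star_eval) auto
qed

theorem theorem6:
  shows "(let \<Delta> = (gelfand_spectrum ::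
              ('a::{locally_convex_algebra, comm_ring} \<Rightarrow> complex) set)
          in \<Delta> \<subseteq> topological_dual
             \<and> closedin weak_star_topology \<Delta>
             \<and> tychonoff_space (subtopology weak_star_topology \<Delta>))
       \<and> (let \<Delta> = (star_gelfand_spectrum ::
              ('b::{locally_convex_star_algebra, comm_ring} \<Rightarrow> complex) set)
          in \<Delta> \<subseteq> topological_dual
             \<and> closedin weak_star_topology \<Delta>
             \<and> tychonoff_space (subtopology weak_star_topology \<Delta>))"
  using closedin_subset[OF closedin_gelfand_spectrum]
    closedin_subset[OF closedin_star_gelfand_spectrum]
  by (simp add: Let_def topspace_weak_star_topology closedin_gelfand_spectrum
      closedin_star_gelfand_spectrum tychonoff_space_subtopology_weak_star)

end
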